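(* Let $k, d$ be integers with $k \geq 1$ and $d \geq 1$, and let $G = BS(kd, kd+d) = \langle\, a, t \mid t^{-1} a^{kd} t = a^{kd+d} \,\rangle$. Then the following statements are true: 1) if $d$ is a power of some prime number or $d = 1$, then $\gamma_\omega G = \langle\, a^{d} \,\rangle^{G}$; 2) if $d > 1$ is not a power of some prime number, then $\gamma_\omega G > \langle\, a^{d} \,\rangle^{G}$, i.e. $\langle\, a^{d} \,\rangle^{G}$ is a proper subgroup of $\gamma_\omega G$.
   Context: For a group $G$, the lower central series is defined by $\gamma_1 G = G$ and $\gamma_{i+1} G = [\gamma_i G, G]$ for $i \geq 1$, where $[A,B]$ denotes the subgroup generated by all commutators $[x,y] = x^{-1}y^{-1}xy$ with $x \in A$, $y \in B$, and $\gamma_\omega G = \bigcap_{i=1}^{\infty} \gamma_i G$. $\langle\, a^{d} \,\rangle^{G}$ denotes the normal closure of $a^d$ in $G$. *)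

theory Defs
  imports "HOL-Algebra.Generated_Groups" "HOL-Number_Theory.Prime_Powers"
begin

text \<open>
  A letter (x, True) stands for the generator x and (x, False) for its formal inverse.
  A relation u = v between words is the pair (u, v). All elements of the type of
  generators are generators.
\<close>

type_synonym 'g word = "('g \<times> bool) list"

inductive word_eq :: "('g word \<times> 'g word) set \<Rightarrow> 'g word \<Rightarrow> 'g word \<Rightarrow> bool" for R where
  refl: "word_eq R u u"
| sym: "word_eq R u v \<Longrightarrow> word_eq R v u"
| trans: "word_eq R u v \<Longrightarrow> word_eq R v w \<Longrightarrow> word_eq R u w"
| append: "word_eq R u u' \<Longrightarrow> word_eq R v v' \<Longrightarrow> word_eq R (u @ v) (u' @ v')"
| cancel: "word_eq R [(x, b), (x, \<not> b)] []"
| relation: "(u, v) \<in> R \<Longrightarrow> word_eq R u v"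

definition word_class :: "('g word \<times> 'g word) set \<Rightarrow> 'g word \<Rightarrow> 'g word set" where
  "word_class R u = {v. word_eq R u v}"

definition presented_group :: "('g word \<times> 'g word) set \<Rightarrow> 'g word set monoid" where
  "presented_group R =
    \<lparr>carrier = range (word_class R),
     monoid.mult = (\<lambda>U V. \<Union>u\<in>U. \<Union>v\<in>V. word_class R (u @ v)),
     one = word_class R []\<rparr>"

definition generator :: "('g word \<times> 'g word) set \<Rightarrow> 'g \<Rightarrow> 'g word set" where
  "generator R x = word_class R [(x, True)]"

lemma word_class_eq_iff: "word_class R u = word_class R v \<longleftrightarrow> word_eq R u v"
proof
  assume "word_class R u = word_class R v"
  then show "word_eq R u v"
    unfolding word_class_def using word_eq.refl[of R v] by auto
next
  assume uv: "word_eq R u v"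
  have "word_eq R u w \<longleftrightarrow> word_eq R v w" for w
    using word_eq.trans[OF uv] word_eq.trans[OF word_eq.sym[OF uv]] by blast
  then show "word_class R u = word_class R v"
    unfolding word_class_def by (rule Collect_cong)
qed

lemma presented_group_mult:
  "word_class R u \<otimes>\<^bsub>presented_group R\<^esub> word_class R v = word_class R (u @ v)"
proof -
  have *: "word_class R (u' @ v') = word_class R (u @ v)"
    if "u' \<in> word_class R u" "v' \<in> word_class R v" for u' v'
  proof -
    have "word_eq R (u @ v) (u' @ v')"
      using that unfolding word_class_def by (intro word_eq.append) simp_all
    then show ?thesis
      unfolding word_class_eq_iff by (rule word_eq.sym)
  qed
  have "u \<in> word_class R u" "v \<in> word_class R v"
    unfolding word_class_def by (simp_all add: word_eq.refl)
  then have "(\<Union>u'\<in>word_class R u. \<Union>v'\<in>word_class R v. word_class R (u' @ v'))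
      = word_class R (u @ v)"
    using * by blast
  then show ?thesis
    by (simp add: presented_group_def)
qed

lemma word_eq_inverse: "word_eq R (rev (map (\<lambda>(x, b). (x, \<not> b)) u) @ u) []"
proof (induction u)
  case Nil
  show ?case by (simp add: word_eq.refl)
next
  case (Cons p u)
  obtain x b where p: "p = (x, b)" by (cases p)
  let ?w = "rev (map (\<lambda>(x, b). (x, \<not> b)) u)"
  have "word_eq R [(x, \<not> b), (x, b)] []"
    using word_eq.cancel[of R x "\<not> b"] by simp
  then have "word_eq R (?w @ ([(x, \<not> b), (x, b)] @ u)) (?w @ ([] @ u))"
    by (intro word_eq.append word_eq.refl)
  then show ?case
    using word_eq.trans[OF _ Cons.IH] by (simp add: p)
qed

lemma group_presented_group: "group (presented_group R)"
proof (rule groupI)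
  let ?G = "presented_group R"
  have carr: "carrier ?G = range (word_class R)" and one: "\<one>\<^bsub>?G\<^esub> = word_class R []"
    by (simp_all add: presented_group_def)
  show "x \<otimes>\<^bsub>?G\<^esub> y \<in> carrier ?G" if "x \<in> carrier ?G" "y \<in> carrier ?G" for x y
    using that by (auto simp: carr presented_group_mult)
  show "\<one>\<^bsub>?G\<^esub> \<in> carrier ?G"
    by (simp add: carr one)
  show "x \<otimes>\<^bsub>?G\<^esub> y \<otimes>\<^bsub>?G\<^esub> z = x \<otimes>\<^bsub>?G\<^esub> (y \<otimes>\<^bsub>?G\<^esub> z)"
    if "x \<in> carrier ?G" "y \<in> carrier ?G" "z \<in> carrier ?G" for x y z
    using that by (auto simp: carr presented_group_mult)
  show "\<one>\<^bsub>?G\<^esub> \<otimes>\<^bsub>?G\<^esub> x = x" if "x \<in> carrier ?G" for x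
    using that by (auto simp: carr one presented_group_mult)
  show "\<exists>y\<in>carrier ?G. y \<otimes>\<^bsub>?G\<^esub> x = \<one>\<^bsub>?G\<^esub>" if "x \<in> carrier ?G" for x
  proof -
    obtain u where "x = word_class R u" using \<open>x \<in> carrier ?G\<close> by (auto simp: carr)
    then show ?thesis
      by (intro bexI[of _ "word_class R (rev (map (\<lambda>(x, b). (x, \<not> b)) u))"])
        (auto simp: carr one presented_group_mult word_class_eq_iff word_eq_inverse)
  qed
qed

datatype bs_gen = Gen_a | Gen_t

definition word_pow :: "'g \<Rightarrow> int \<Rightarrow> 'g word" where
  "word_pow x n = replicate (nat \<bar>n\<bar>) (x, n \<ge> 0)"

definition BS_relations :: "int \<Rightarrow> int \<Rightarrow> (bs_gen word \<times> bs_gen word) set" where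
  "BS_relations m n =
    {(word_pow Gen_t (-1) @ word_pow Gen_a m @ word_pow Gen_t 1, word_pow Gen_a n)}"

definition BS :: "int \<Rightarrow> int \<Rightarrow> bs_gen word set monoid" where
  "BS m n = presented_group (BS_relations m n)"

definition BS_a :: "int \<Rightarrow> int \<Rightarrow> bs_gen word set" where
  "BS_a m n = generator (BS_relations m n) Gen_a"

definition commutator_subgroup :: "('a, 'b) monoid_scheme \<Rightarrow> 'a set \<Rightarrow> 'a set \<Rightarrow> 'a set" where
  "commutator_subgroup G A B =
    generate G {inv\<^bsub>G\<^esub> x \<otimes>\<^bsub>G\<^esub> inv\<^bsub>G\<^esub> y \<otimes>\<^bsub>G\<^esub> x \<otimes>\<^bsub>G\<^esub> y | x y. x \<in> A \<and> y \<in> B}"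

text \<open>The series starts at index 1; the value at index 0 is a dummy.\<close>

fun lower_central :: "('a, 'b) monoid_scheme \<Rightarrow> nat \<Rightarrow> 'a set" where
  "lower_central G 0 = carrier G"
| "lower_central G (Suc 0) = carrier G"
| "lower_central G (Suc (Suc i)) = commutator_subgroup G (lower_central G (Suc i)) (carrier G)"

definition lower_central_omega :: "('a, 'b) monoid_scheme \<Rightarrow> 'a set" where
  "lower_central_omega G = (\<Inter>i\<in>{1..}. lower_central G i)"

definition normal_closure :: "('a, 'b) monoid_scheme \<Rightarrow> 'a set \<Rightarrow> 'a set" where
  "normal_closure G S = \<Inter>{N. N \<lhd> G \<and> S \<subseteq> N}"

end

(* From [a^(kd), t] = a^d it follows by induction that a^d lies in every term of the lower
   central series. Modulo its normal closure N the group becomes Z/d * Z.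

   If d = p^e, write an element outside N as a reduced alternating word and replace the
   exponents of t by their residues modulo a large power of p. The Magnus substitution
   a -> 1 + X, t -> 1 + T over Z/p is well defined modulo X^d, and the monomial formed by the
   syllables of the word with their full exponents occurs with coefficient 1. An element of the
   i-th term of the lower central series has no monomials of degree between 1 and i - 1. Only
   the subwords of one monomial matter, so the power series are replaced by matrices acting on
   sequences, with X and T shifting along the edges of a path labelled by that monomial.

   If d = u v with coprime u, v > 1, then a^u and t^-1 a^v t have coprime orders modulo every
   term of the lower central series, hence their commutator lies in all terms. It is not in N,
   because these elements do not commute when a acts on the integers as the cycle (0 1 ... d-1)
   and t as the transposition (0 d). *)

theory Submission
  imports Defs "HOL-Number_Theory.Cong" "HOL-Library.Function_Algebras"
begin

text \<open>The identity i * (p^e choose i) = p^e * (p^e - 1 choose i - 1) would force p^e to divide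
  i if p did not divide the binomial coefficient.\<close>

lemma prime_dvd_choose_prime_power:
  fixes p :: nat
  assumes "prime p" "0 < i" "i < p ^ e"
  shows "p dvd (p ^ e choose i)"
proof (rule ccontr)
  assume "\<not> p dvd (p ^ e choose i)"
  then have "coprime (p ^ e) (p ^ e choose i)"
    using assms(1) by (simp add: prime_imp_coprime)
  moreover have "p ^ e dvd i * (p ^ e choose i)"
    using times_binomial_minus1_eq[OF assms(2), of "p ^ e"] by simp
  ultimately have "p ^ e dvd i"
    by (simp add: coprime_dvd_mult_left_iff)
  then show False
    using assms by (auto dest: dvd_imp_le)
qed

section \<open>Shears and labelled paths\<close>

text \<open>The matrix 1 + X, where X shifts along those edges i -> i + 1 that satisfy
  \<open>P i\<close>.\<close>

definition shear :: "(nat \<Rightarrow> bool) \<Rightarrow> (nat \<Rightarrow> int) \<Rightarrow> nat \<Rightarrow> int" where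
  "shear P v j = v j + (case j of 0 \<Rightarrow> 0 | Suc i \<Rightarrow> if P i then v i else 0)"

text \<open>Forward substitution: 1 + X is lower unitriangular, so its inverse is computed entry by
  entry over the integers.\<close>

primrec unshear :: "(nat \<Rightarrow> bool) \<Rightarrow> (nat \<Rightarrow> int) \<Rightarrow> nat \<Rightarrow> int" where
  "unshear P v 0 = v 0"
| "unshear P v (Suc i) = v (Suc i) - (if P i then unshear P v i else 0)"

lemma shear_unshear: "shear P (unshear P v) = v"
  by (rule ext) (simp add: shear_def split: nat.split)

lemma unshear_shear: "unshear P (shear P v) = v"
proof
  show "unshear P (shear P v) j = v j" for j
    by (induction j) (simp_all add: shear_def)
qed

lemma shear_add: "shear P (v + w) = shear P v + shear P w"
  by (rule ext) (simp add: shear_def split: nat.split)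

lemma unshear_add: "unshear P (v + w) = unshear P v + unshear P w"
proof
  show "unshear P (v + w) j = (unshear P v + unshear P w) j" for j
    by (induction j) simp_all
qed

text \<open>Binomial theorem for 1 + X: the power X^i carries entry j - i to entry j exactly when
  all edges between them satisfy P.\<close>

lemma funpow_shear:
  "(shear P ^^ n) v j =
    (\<Sum>i\<le>j. int (n choose i) * (if \<forall>l\<in>{j - i..<j}. P l then v (j - i) else 0))"
proof (induction n arbitrary: j)
  case 0
  have "(\<Sum>i\<le>j. int (0 choose i) * (if \<forall>l\<in>{j - i..<j}. P l then v (j - i) else 0))
      = (\<Sum>i\<le>j. if i = 0 then v j else 0)"
    by (intro sum.cong) (auto simp: binomial_eq_0)
  then show ?case by simp
next
  case (Suc n)
  show ?case
  proof (cases j)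
    case 0
    have "(shear P ^^ Suc n) v 0 = (shear P ^^ n) v 0"
      by (simp add: shear_def)
    then show ?thesis by (simp add: Suc.IH 0)
  next
    case (Suc j')
    let ?Q = "\<lambda>i. if \<forall>l\<in>{j' - i..<Suc j'}. P l then v (j' - i) else 0"
    have Q: "?Q i = (if P j' then if \<forall>l\<in>{j' - i..<j'}. P l then v (j' - i) else 0 else 0)" for i
      by (auto simp: less_Suc_eq)
    \<comment> \<open>Stated for any upper index N, since it is applied to n and to
      \<open>Suc n\<close>; Pascal's rule then connects the two sums.\<close>
    have split: "(\<Sum>i\<le>Suc j'. int (N choose i) * (if \<forall>l\<in>{Suc j' - i..<Suc j'}. P l
        then v (Suc j' - i) else 0)) = v (Suc j') + (\<Sum>i\<le>j'. int (N choose Suc i) * ?Q i)" for N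
      by (subst sum.atMost_Suc_shift) (simp cong: if_cong)
    have "(shear P ^^ Suc n) v (Suc j') =
        (shear P ^^ n) v (Suc j') + (if P j' then (shear P ^^ n) v j' else 0)"
      by (simp add: shear_def)
    also have "(if P j' then (shear P ^^ n) v j' else 0) = (\<Sum>i\<le>j'. int (n choose i) * ?Q i)"
      unfolding Suc.IH Q by simp
    also have "(shear P ^^ n) v (Suc j') = v (Suc j') + (\<Sum>i\<le>j'. int (n choose Suc i) * ?Q i)"
      unfolding Suc.IH by (rule split)
    finally show ?thesis
      unfolding Suc split by (simp add: sum.distrib algebra_simps)
  qed
qed

section \<open>Shears modulo p\<close>

definition vec_cong :: "int \<Rightarrow> (nat \<Rightarrow> int) \<Rightarrow> (nat \<Rightarrow> int) \<Rightarrow> bool" where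
  "vec_cong p v w \<longleftrightarrow> (\<forall>j. [v j = w j] (mod p))"

lemma equivp_vec_cong: "equivp (vec_cong p)"
  by (rule equivpI)
    (auto simp: reflp_def symp_def transp_def vec_cong_def intro: cong_sym cong_trans)

lemma shear_cong: "vec_cong p v w \<Longrightarrow> vec_cong p (shear P v) (shear P w)"
  by (auto simp: vec_cong_def shear_def split: nat.split intro!: cong_add)

lemma unshear_cong:
  assumes "vec_cong p v w"
  shows "vec_cong p (unshear P v) (unshear P w)"
  unfolding vec_cong_def
proof
  show "[unshear P v j = unshear P w j] (mod p)" for j
    using assms by (induction j) (auto simp: vec_cong_def intro!: cong_diff)
qed

text \<open>Modulo p, (1 + X)^(p^e) = 1 + X^(p^e), and X^(p^e) = 0 because no p^e consecutive edges
  satisfy P.\<close>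

lemma funpow_shear_prime_power:
  fixes p :: nat
  assumes p: "prime p" and window: "\<And>j. \<exists>l\<in>{j..<j + p ^ e}. \<not> P l"
  shows "vec_cong p ((shear P ^^ (p ^ e)) v) v"
  unfolding vec_cong_def
proof
  fix j
  let ?x = "\<lambda>i. int (p ^ e choose i) * (if \<forall>l\<in>{j - i..<j}. P l then v (j - i) else 0)"
  have "[?x i = (if i = 0 then v j else 0)] (mod int p)" if "i \<le> j" for i
  proof -
    consider "i = 0" | "0 < i" "i < p ^ e" | "i = p ^ e" "0 < i" | "i > p ^ e"
      by linarith
    then show ?thesis
    proof cases
      case 2
      then have "int p dvd int (p ^ e choose i)"
        using prime_dvd_choose_prime_power[OF p] by simp
      then show ?thesis
        using 2 by (simp add: cong_0_iff)
    next
      case 3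
      then show ?thesis
        using window[of "j - i"] that by auto
    qed (simp_all add: binomial_eq_0)
  qed
  then have "[(\<Sum>i\<le>j. ?x i) = (\<Sum>i\<le>j. if i = 0 then v j else 0)] (mod int p)"
    by (intro cong_sum) simp
  then show "[(shear P ^^ (p ^ e)) v j = v j] (mod int p)"
    unfolding funpow_shear by simp
qed

text \<open>Syllables are laid out from the last to the first, since the last one acts first.\<close>

fun path :: "('g \<times> nat) list \<Rightarrow> 'g list" where
  "path [] = []"
| "path ((g, n) # L) = path L @ replicate n g"

lemma path_last:
  assumes "L \<noteq> []" "\<forall>(g, n)\<in>set L. 0 < n"
  shows "path L \<noteq> []" "path L ! (length (path L) - 1) = fst (hd L)"
  using assms by (cases L; force simp: nth_append)+

text \<open>Neighbouring syllables carry different generators, so a run of edges labelled h stays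
  inside one syllable, which is shorter than \<open>q h\<close>.\<close>

lemma path_window:
  assumes "distinct_adj (map fst L)" "\<forall>(g, n)\<in>set L. 0 < n \<and> n < q g" "0 < q h"
    "j + q h \<le> length (path L)"
  shows "\<exists>l\<in>{j..<j + q h}. path L ! l \<noteq> h"
  using assms
proof (induction L rule: path.induct)
  case 1
  then show ?case by simp
next
  case (2 g n L)
  let ?M = "length (path L)"
  consider "j + q h \<le> ?M" | "?M < j + q h" "h \<noteq> g" | "?M < j + q h" "h = g"
    by linarith
  then show ?case
  proof cases
    case 1
    then obtain l where "l \<in> {j..<j + q h}" "path L ! l \<noteq> h"
      using 2 by (fastforce dest: distinct_adj_ConsD)
    then show ?thesis
      using 1 by (intro bexI[of _ l]) (auto simp: nth_append)
  next
    case b: 2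
    then show ?thesis
      using 2 by (intro bexI[of _ "j + q h - 1"]) (auto simp: nth_append)
  next
    case c: 3
    \<comment> \<open>The window is longer than the block of the syllable (g, n), so it starts
      before that block and contains the edge preceding it, which has another label.\<close>
    have j: "j < ?M"
      using 2 c by auto
    then have "L \<noteq> []" by auto
    then have "path L ! (?M - 1) \<noteq> h"
      using path_last(2)[of L] 2 c by (auto simp: distinct_adj_Cons hd_map)
    then show ?thesis
      using j c by (intro bexI[of _ "?M - 1"]) (auto simp: nth_append)
  qed
qed

definition start :: "nat \<Rightarrow> int" where
  "start j = (if j = 0 then 1 else 0)"

text \<open>Starting at vertex 0, the end of the path is reached only by taking every syllable with
  its full exponent, and each syllable contributes n choose n = 1. The vanishing beyond the end is
  what carries the induction.\<close>

lemma foldr_shear_path: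
  assumes "\<And>j. j < length (path L) \<Longrightarrow> P (path L ! j) j"
  shows "foldr (\<lambda>(g, n). shear (P g) ^^ n) L start (length (path L)) = 1 \<and>
    (\<forall>j>length (path L). foldr (\<lambda>(g, n). shear (P g) ^^ n) L start j = 0)"
  using assms
proof (induction L rule: path.induct)
  case 1
  then show ?case by (simp add: start_def)
next
  case (2 g n L)
  let ?M = "length (path L)" and ?v = "foldr (\<lambda>(g, n). shear (P g) ^^ n) L start"
  have "P (path L ! j) j" if "j < ?M" for j
    using 2(2)[of j] that by (auto simp: nth_append)
  then have v: "?v ?M = 1" "\<And>j. j > ?M \<Longrightarrow> ?v j = 0"
    using 2(1) by auto
  have P: "P g j" if "?M \<le> j" "j < ?M + n" for j
    using 2(2)[of j] that by (auto simp: nth_append)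
  have "(shear (P g) ^^ n) ?v (?M + n) = (\<Sum>i\<le>?M + n. if i = n then 1 else 0)"
  proof (subst funpow_shear, rule sum.cong)
    fix i assume "i \<in> {..?M + n}"
    consider "i < n" | "i = n" | "i > n" by linarith
    then show "int (n choose i) * (if \<forall>l\<in>{?M + n - i..<?M + n}. P g l then ?v (?M + n - i) else 0)
        = (if i = n then 1 else 0)"
      by cases (use P v in \<open>auto simp: binomial_eq_0\<close>)
  qed simp
  moreover have "(shear (P g) ^^ n) ?v j = 0" if "j > ?M + n" for j
  proof (subst funpow_shear, rule sum.neutral, rule)
    fix i assume "i \<in> {..j}"
    consider "i \<le> n" | "i > n" by linarith
    then show "int (n choose i) * (if \<forall>l\<in>{j - i..<j}. P g l then ?v (j - i) else 0) = 0"
      by cases (use that v in \<open>auto simp: binomial_eq_0\<close>)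
  qed
  ultimately show ?case by simp
qed

section \<open>Lower central series\<close>

text \<open>The action is only required to respect products up to vectors in all \<open>F n\<close>: the shears
  satisfy the relation of the group modulo \<open>p\<close>, not over the integers.\<close>

lemma lower_central_shift:
  fixes F :: "nat \<Rightarrow> 'v::ab_group_add set" and G (structure)
  assumes G: "group G"
    and zero: "\<And>n. 0 \<in> F n"
    and diff: "\<And>n v w. v \<in> F n \<Longrightarrow> w \<in> F n \<Longrightarrow> v - w \<in> F n"
    and anti: "\<And>n. F (Suc n) \<subseteq> F n"
    and add: "\<And>x v w. act x (v + w) = act x v + act x w"
    and shift: "\<And>x v n. x \<in> carrier G \<Longrightarrow> v \<in> F n \<Longrightarrow> act x v - v \<in> F (Suc n)"
    and mult: "\<And>x y v n. x \<in> carrier G \<Longrightarrow> y \<in> carrier G \<Longrightarrow> act (x \<otimes> y) v - act x (act y v) \<in> F n"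
    and one: "\<And>v n. act \<one> v - v \<in> F n"
    and "0 < i" "x \<in> lower_central G i" "v \<in> F n"
  shows "act x v - v \<in> F (n + i)"
proof -
  interpret group G by (rule G)
  have plus: "v + w \<in> F n" if "v \<in> F n" "w \<in> F n" for v w n
    using diff[OF that(1) diff[OF zero that(2)]] by simp
  \<comment> \<open>\<open>K i\<close> consists of the elements acting trivially on every
    \<open>F n\<close> modulo \<open>F (n + i)\<close>. Each \<open>K i\<close> is a subgroup, and
    commutators of \<open>K i\<close> with G lie in \<open>K (Suc i)\<close>, so induction puts the
    lower central series inside.\<close>
  define K where "K i = {x \<in> carrier G. \<forall>n. \<forall>v\<in>F n. act x v - v \<in> F (n + i)}" for i
  have stable: "act x v \<in> F n" if "x \<in> carrier G" "v \<in> F n" for x v n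
    using plus[OF _ that(2), of "act x v - v"] shift[OF that] anti by auto
  \<comment> \<open>Up to elements of every \<open>F n\<close>, the inverse of x undoes x.\<close>
  have act_inv: "act (inv x) (act x v) - v \<in> F n" "act x (act (inv x) v) - v \<in> F n"
    if x: "x \<in> carrier G" for x v n
    using diff[OF one[of v n] mult[of "inv x" x v n]] diff[OF one[of v n] mult[of x "inv x" v n]] x
    by (simp_all add: algebra_simps)
  have subK: "subgroup (K i) G" for i
  proof (rule subgroupI)
    show "K i \<subseteq> carrier G" by (auto simp: K_def)
    have "\<one> \<in> K i" using one by (auto simp: K_def)
    then show "K i \<noteq> {}" by auto
  next
    fix x assume x: "x \<in> K i"
    have "act (inv x) v - v \<in> F (n + i)" if v: "v \<in> F n" for v n
    proof -
      let ?w = "act (inv x) v"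
      have "?w \<in> F n" using stable x v by (auto simp: K_def)
      then have "act x ?w - ?w \<in> F (n + i)" using x by (auto simp: K_def)
      from diff[OF act_inv(2)[of x v] this] x show ?thesis
        by (auto simp: K_def)
    qed
    then show "inv x \<in> K i" using x by (auto simp: K_def)
  next
    fix x y assume x: "x \<in> K i" and y: "y \<in> K i"
    have "act (x \<otimes> y) v - v \<in> F (n + i)" if v: "v \<in> F n" for v n
    proof -
      have "act y v \<in> F n" using stable y v by (auto simp: K_def)
      then have "act x (act y v) - act y v \<in> F (n + i)" using x by (auto simp: K_def)
      moreover have "act y v - v \<in> F (n + i)" using y v by (auto simp: K_def)
      moreover have "act (x \<otimes> y) v - act x (act y v) \<in> F (n + i)"
        using mult x y by (auto simp: K_def)
      ultimately have "(act (x \<otimes> y) v - act x (act y v)) + ((act x (act y v) - act y v)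
          + (act y v - v)) \<in> F (n + i)"
        by (intro plus)
      then show ?thesis by simp
    qed
    then show "x \<otimes> y \<in> K i" using x y by (auto simp: K_def)
  qed
  have comm: "inv x \<otimes> inv y \<otimes> x \<otimes> y \<in> K (Suc i)" if x: "x \<in> K i" and y: "y \<in> carrier G" for x y i
  proof -
    have xc: "x \<in> carrier G" using x by (simp add: K_def)
    let ?c = "inv x \<otimes> inv y \<otimes> x \<otimes> y"
    have c: "?c = inv (y \<otimes> x) \<otimes> (x \<otimes> y)"
      using xc y by (simp add: inv_mult_group m_assoc)
    have "act ?c v - v \<in> F (n + Suc i)" if v: "v \<in> F n" for v n
    proof -
      \<comment> \<open>Here A = (x - 1) v and B = (y - 1) v. By xy - yx = (x - 1)(y - 1) - (y -
        1)(x - 1), the two products decide: in each, one factor raises the index by i and the other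
        by 1.\<close>
      let ?B = "act y v - v" and ?A = "act x v - v"
      have B: "act x ?B - ?B \<in> F (n + Suc i)"
        using shift[OF y v] x unfolding K_def by force
      have A: "act y ?A - ?A \<in> F (n + Suc i)"
        using shift[OF y, of ?A "n + i"] x v by (auto simp: K_def)
      have "act x (act y v) = act x v + act x ?B" "act y (act x v) = act y v + act y ?A"
        using add[of x v ?B] add[of y v ?A] by simp_all
      then have "act x (act y v) - act y (act x v) \<in> F (n + Suc i)"
        using diff[OF B A] by (simp add: algebra_simps)
      from plus[OF diff[OF mult[of x y v] mult[of y x v]] this] xc y
      have z: "act (x \<otimes> y) v - act (y \<otimes> x) v \<in> F (n + Suc i)" (is "?z \<in> _")
        by (simp add: algebra_simps)
      \<comment> \<open>Applying g = (yx)^-1 to (xy) v = z + (yx) v turns the left side into c v and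
        the right side into g z + v, up to elements of the filtration step.\<close>
      let ?g = "inv (y \<otimes> x)"
      have g: "?g \<in> carrier G" using xc y by simp
      have "act ?g (act (x \<otimes> y) v) = act ?g ?z + act ?g (act (y \<otimes> x) v)"
        using add[of ?g ?z "act (y \<otimes> x) v"] by simp
      moreover have "act ?g ?z \<in> F (n + Suc i)"
        by (rule stable[OF g z])
      moreover have "act ?g (act (y \<otimes> x) v) - v \<in> F (n + Suc i)"
        by (rule act_inv) (use xc y in simp)
      moreover have "act ?c v - act ?g (act (x \<otimes> y) v) \<in> F (n + Suc i)"
        unfolding c by (rule mult) (use xc y in simp_all)
      ultimately have "(act ?c v - act ?g (act (x \<otimes> y) v)) + (act ?g ?z
          + (act ?g (act (y \<otimes> x) v) - v)) \<in> F (n + Suc i)"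
        by (intro plus)
      with \<open>act ?g (act (x \<otimes> y) v) = _\<close> show ?thesis
        by (simp add: algebra_simps)
    qed
    then show ?thesis using xc y by (auto simp: K_def)
  qed
  have K1: "lower_central G (Suc i) \<subseteq> K (Suc i)" for i
  proof (induction i)
    case 0
    show ?case using shift by (auto simp: K_def)
  next
    case (Suc i)
    then show ?case
      unfolding lower_central.simps commutator_subgroup_def
      by (intro generate_subgroup_incl[OF _ subK]) (auto intro: comm)
  qed
  then show ?thesis
    using assms(9-11) by (cases i) (auto simp: K_def)
qed

lemma (in group) inv_mult_cancel_left:
  assumes "x \<in> carrier G" "y \<in> carrier G"
  shows "inv x \<otimes> (x \<otimes> y) = y" "x \<otimes> (inv x \<otimes> y) = y"
  using assms by (simp_all flip: m_assoc)

text \<open>A conjugate of a commutator is the commutator of the conjugates, so normality passes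
  from each term to the generators of the next.\<close>

lemma (in group) lower_central_normal:
  assumes "0 < i"
  shows "lower_central G i \<lhd> G"
proof -
  have "lower_central G (Suc i) \<lhd> G" for i
  proof (induction i)
    case 0
    show ?case by (simp add: normal_inv_iff subgroup_self)
  next
    case (Suc i)
    let ?H = "lower_central G (Suc i)"
    interpret H: normal ?H G by (rule Suc)
    have conj: "g \<otimes> (inv x \<otimes> inv y \<otimes> x \<otimes> y) \<otimes> inv g =
        inv (g \<otimes> x \<otimes> inv g) \<otimes> inv (g \<otimes> y \<otimes> inv g) \<otimes> (g \<otimes> x \<otimes> inv g) \<otimes> (g \<otimes> y \<otimes> inv g)"
      if "g \<in> carrier G" "x \<in> carrier G" "y \<in> carrier G" for g x y
      using that by (simp add: inv_mult_group m_assoc inv_mult_cancel_left)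
    show ?case
      unfolding lower_central.simps commutator_subgroup_def
    proof (rule normal_generateI)
      show "{inv x \<otimes> inv y \<otimes> x \<otimes> y |x y. x \<in> ?H \<and> y \<in> carrier G} \<subseteq> carrier G"
        by auto
    next
      fix h g
      assume g: "g \<in> carrier G" and "h \<in> {inv x \<otimes> inv y \<otimes> x \<otimes> y |x y. x \<in> ?H \<and> y \<in> carrier G}"
      then obtain x y where h: "h = inv x \<otimes> inv y \<otimes> x \<otimes> y" and x: "x \<in> ?H" and y: "y \<in> carrier G"
        by blast
      have "g \<otimes> x \<otimes> inv g \<in> ?H" "g \<otimes> y \<otimes> inv g \<in> carrier G"
        using H.inv_op_closed2[OF g x] g y by simp_all
      then show "g \<otimes> h \<otimes> inv g \<in> {inv x \<otimes> inv y \<otimes> x \<otimes> y |x y. x \<in> ?H \<and> y \<in> carrier G}"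
        unfolding h conj[OF g H.mem_carrier[OF x] y] by blast
    qed
  qed
  then show ?thesis using assms by (cases i) auto
qed

lemma (in group) normal_closure_normal:
  assumes "S \<subseteq> carrier G"
  shows "normal_closure G S \<lhd> G"
proof -
  have "carrier G \<lhd> G" by (simp add: normal_inv_iff subgroup_self)
  then have "subgroup (normal_closure G S) G"
    unfolding normal_closure_def using assms
    by (intro subgroups_Inter) (auto simp: normal_imp_subgroup)
  then show ?thesis
    unfolding normal_inv_iff normal_closure_def by (auto simp: normal_inv_iff)
qed

lemma (in group) normal_closure_incl: "S \<subseteq> normal_closure G S"
  by (auto simp: normal_closure_def)

lemma (in group) normal_closure_least: "M \<lhd> G \<Longrightarrow> S \<subseteq> M \<Longrightarrow> normal_closure G S \<subseteq> M"
  by (auto simp: normal_closure_def)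

section \<open>Commutators of elements with coprime orders\<close>

lemma (in group) commutator_mem_lower_central:
  "x \<in> lower_central G (Suc i) \<Longrightarrow> y \<in> carrier G \<Longrightarrow>
    inv x \<otimes> inv y \<otimes> x \<otimes> y \<in> lower_central G (Suc (Suc i))"
  by (auto simp: commutator_subgroup_def intro!: generate.incl)

text \<open>Moving y to the left past each factor x leaves one c behind, and since c commutes with x
  these can be collected on the right.\<close>

lemma (in group) pow_central_commutator:
  fixes n :: nat
  assumes "x \<in> carrier G" "y \<in> carrier G" "c \<in> carrier G"
    and "x \<otimes> y = y \<otimes> x \<otimes> c" "c \<otimes> x = x \<otimes> c"
  shows "x [^] n \<otimes> y = y \<otimes> x [^] n \<otimes> c [^] n"
proof (induction n)
  case (Suc n)
  have cx: "c [^] n \<otimes> x = x \<otimes> c [^] n"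
    using assms by (intro group_commutes_pow)
  have "x [^] Suc n \<otimes> y = (x [^] n \<otimes> y) \<otimes> (x \<otimes> c)"
    using assms by (simp add: m_assoc)
  also have "\<dots> = y \<otimes> x [^] n \<otimes> (c [^] n \<otimes> x) \<otimes> c"
    unfolding Suc using assms(1-3) by (simp add: m_assoc)
  also have "\<dots> = y \<otimes> x [^] Suc n \<otimes> c [^] Suc n"
    unfolding cx using assms(1-3) by (simp add: m_assoc)
  finally show ?case .
qed (use assms in simp)

lemma (in group) mult_eq_swap_commutator:
  assumes "x \<in> carrier G" "y \<in> carrier G"
  shows "x \<otimes> y = y \<otimes> x \<otimes> (inv x \<otimes> inv y \<otimes> x \<otimes> y)"
  using assms by (simp add: m_assoc inv_mult_cancel_left)

text \<open>With c central in the relevant sense, c^u = [x^u, y] and c^(-v) = [y^v, x] are trivial,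
  so the order of c divides two coprime numbers.\<close>

lemma (in group) coprime_pow_commutator_trivial:
  fixes u v :: nat
  assumes x: "x \<in> carrier G" and y: "y \<in> carrier G" and c: "c \<in> carrier G"
    and xy: "x \<otimes> y = y \<otimes> x \<otimes> c" and cx: "c \<otimes> x = x \<otimes> c" and cy: "c \<otimes> y = y \<otimes> c"
    and "coprime u v" and xu: "x [^] u = \<one>" and yv: "y [^] v = \<one>"
  shows "c = \<one>"
proof -
  have cu: "c [^] u = \<one>"
    using pow_central_commutator[OF x y c xy cx, of u] xu x y c by simp
  \<comment> \<open>The same computation with x and y exchanged, which replaces c by its
    inverse.\<close>
  have "inv c \<otimes> y = y \<otimes> inv c"
    using cy y c by (metis inv_closed inv_mult_cancel_left(1) m_assoc m_closed r_inv r_one)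
  moreover have "y \<otimes> x = x \<otimes> y \<otimes> inv c"
    unfolding xy using x y c by (simp add: m_assoc)
  ultimately have "y [^] v \<otimes> x = x \<otimes> y [^] v \<otimes> inv c [^] v"
    using x y c by (intro pow_central_commutator) simp_all
  then have cv: "c [^] v = \<one>"
    using yv x y c by (simp add: nat_pow_inv)
  obtain r s :: int where rs: "r * int u + s * int v = 1"
    using bezout_int[of "int u" "int v"] \<open>coprime u v\<close> by auto
  have "c = c [^] (int u * r + int v * s)"
    using rs c by (simp add: mult.commute)
  also have "\<dots> = \<one>"
    using c cu cv by (simp add: int_pow_mult int_pow_int flip: int_pow_pow)
  finally show ?thesis .
qed

text \<open>Induction along the series: once the commutator lies in one term, it is central modulo
  the next, where the preceding lemma makes it trivial.\<close>

lemma (in group) coprime_pow_commutator: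
  fixes u v :: nat
  assumes x: "x \<in> carrier G" and y: "y \<in> carrier G" and uv: "coprime u v"
    and xu: "\<And>i. x [^] u \<in> lower_central G (Suc i)"
    and yv: "\<And>i. y [^] v \<in> lower_central G (Suc i)"
  shows "inv x \<otimes> inv y \<otimes> x \<otimes> y \<in> lower_central G (Suc i)"
proof (induction i)
  case 0
  then show ?case using x y by simp
next
  case (Suc i)
  define c where "c = inv x \<otimes> inv y \<otimes> x \<otimes> y"
  define H where "H = lower_central G (Suc (Suc i))"
  interpret H: normal H G unfolding H_def by (rule lower_central_normal) simp
  define Q where "Q = G Mod H"
  interpret Q: group Q unfolding Q_def by (rule H.factorgroup_is_group)
  define \<pi> where "\<pi> = (\<lambda>z. H #> z)"
  interpret \<pi>: group_hom G Q \<pi>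
    by unfold_locales (use H.r_coset_hom_Mod in \<open>simp add: \<pi>_def Q_def\<close>)
  have \<pi>1: "\<pi> z = \<one>\<^bsub>Q\<^esub> \<longleftrightarrow> z \<in> H" if "z \<in> carrier G" for z
    using that coset_join1[OF _ _ H.subgroup_axioms] coset_join2[OF _ H.subgroup_axioms]
    unfolding \<pi>_def Q_def FactGroup_def by auto
  have c: "c \<in> carrier G" using x y by (simp add: c_def)
  have central: "\<pi> c \<otimes>\<^bsub>Q\<^esub> \<pi> z = \<pi> z \<otimes>\<^bsub>Q\<^esub> \<pi> c" if z: "z \<in> carrier G" for z
  proof -
    \<comment> \<open>The commutator of c with z falls into H by the induction hypothesis, so c and
      z commute in the quotient.\<close>
    define e where "e = inv c \<otimes> inv z \<otimes> c \<otimes> z"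
    have e: "e \<in> carrier G" "e \<in> H"
      using commutator_mem_lower_central[OF Suc z] c z by (simp_all only: e_def c_def H_def m_closed inv_closed)
    have "c \<otimes> z = z \<otimes> c \<otimes> e"
      unfolding e_def by (rule mult_eq_swap_commutator[OF c z])
    then have "\<pi> (c \<otimes> z) = \<pi> (z \<otimes> c \<otimes> e)" by simp
    then show ?thesis
      using c z e \<pi>1[of e] by simp
  qed
  have "x \<otimes> y = y \<otimes> x \<otimes> c"
    unfolding c_def by (rule mult_eq_swap_commutator[OF x y])
  then have "\<pi> (x \<otimes> y) = \<pi> (y \<otimes> x \<otimes> c)" by simp
  then have "\<pi> x \<otimes>\<^bsub>Q\<^esub> \<pi> y = \<pi> y \<otimes>\<^bsub>Q\<^esub> \<pi> x \<otimes>\<^bsub>Q\<^esub> \<pi> c"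
    using x y c by simp
  moreover have "\<pi> x [^]\<^bsub>Q\<^esub> u = \<one>\<^bsub>Q\<^esub>" "\<pi> y [^]\<^bsub>Q\<^esub> v = \<one>\<^bsub>Q\<^esub>"
    using \<pi>1 xu[of "Suc i"] yv[of "Suc i"] x y by (simp_all only: flip: H_def \<pi>.hom_nat_pow, simp_all)
  ultimately have "\<pi> c = \<one>\<^bsub>Q\<^esub>"
    using central[OF x] central[OF y] x y c uv
    by (intro Q.coprime_pow_commutator_trivial[of "\<pi> x" "\<pi> y" "\<pi> c" u v]) simp_all
  then have "c \<in> H"
    using \<pi>1 c by blast
  then show ?case by (simp only: c_def H_def)
qed

section \<open>Presented groups and their actions\<close>

lemma carrier_presented_group: "carrier (presented_group R) = range (word_class R)"
  by (simp add: presented_group_def)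

lemma word_class_closed [simp]: "word_class R u \<in> carrier (presented_group R)"
  by (simp add: carrier_presented_group)

lemma one_presented_group: "\<one>\<^bsub>presented_group R\<^esub> = word_class R []"
  by (simp add: presented_group_def)

lemma word_class_replicate:
  "word_class R (replicate n l) = word_class R [l] [^]\<^bsub>presented_group R\<^esub> n"
proof (induction n)
  case (Suc n)
  interpret group "presented_group R" by (rule group_presented_group)
  have "word_class R (replicate (Suc n) l) = word_class R [l] \<otimes>\<^bsub>presented_group R\<^esub> word_class R (replicate n l)"
    by (simp add: presented_group_mult)
  then show ?case
    unfolding nat_pow_Suc2[OF word_class_closed] Suc .
qed (simp add: one_presented_group)

lemma word_class_word_pow:
  "word_class R (word_pow x n) = generator R x [^]\<^bsub>presented_group R\<^esub> n"
proof -
  interpret group "presented_group R" by (rule group_presented_group)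
  have inv: "word_class R [(x, False)] = inv\<^bsub>presented_group R\<^esub> generator R x"
    using word_eq.cancel[of R x False]
    by (intro inv_equality[symmetric])
      (simp_all add: generator_def one_presented_group presented_group_mult word_class_eq_iff)
  show ?thesis
  proof (cases "n \<ge> 0")
    case True
    then show ?thesis
      by (simp add: word_pow_def word_class_replicate generator_def pow_nat)
  next
    case False
    then have "word_class R (word_pow x n) = (inv\<^bsub>presented_group R\<^esub> generator R x) [^]\<^bsub>presented_group R\<^esub> nat (- n)"
      by (simp add: word_pow_def word_class_replicate inv)
    also have "\<dots> = generator R x [^]\<^bsub>presented_group R\<^esub> n"
      using False int_pow_neg[of "generator R x" "- n"]
      by (simp add: int_pow_inv generator_def)
    finally show ?thesis .
  qed
qed

lemma generator_closed [simp]: "generator R x \<in> carrier (presented_group R)"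
  by (simp add: generator_def)

section \<open>Reduced words modulo a normal subgroup\<close>

definition syllables :: "('g \<times> int) list \<Rightarrow> 'g word" where
  "syllables l = concat (map (\<lambda>(g, n). word_pow g n) l)"

text \<open>A generator \<open>g\<close> with \<open>q g = 0\<close> has infinite order in the quotient.\<close>

definition reduced :: "('g \<Rightarrow> int) \<Rightarrow> ('g \<times> int) list \<Rightarrow> bool" where
  "reduced q l \<longleftrightarrow> distinct_adj (map fst l) \<and> (\<forall>(g, n)\<in>set l. \<not> q g dvd n)"

lemma reduced_Cons:
  "reduced q ((g, n) # l) \<longleftrightarrow> reduced q l \<and> \<not> q g dvd n \<and> (l = [] \<or> fst (hd l) \<noteq> g)"
  by (auto simp: reduced_def distinct_adj_Cons hd_map)

text \<open>The existence half of the normal form for a free product of cyclic groups. Letters are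
  prepended one at a time; syllables that become trivial modulo N are absorbed into the factor from
  N.\<close>

lemma reduced_syllables:
  assumes N: "N \<lhd> presented_group R"
    and q: "\<And>g. generator R g [^]\<^bsub>presented_group R\<^esub> q g \<in> N"
    and x: "x \<in> carrier (presented_group R)"
  shows "\<exists>l. \<exists>n\<in>N. reduced q l \<and> x = n \<otimes>\<^bsub>presented_group R\<^esub> word_class R (syllables l)"
proof -
  let ?G = "presented_group R" and ?W = "\<lambda>l. word_class R (syllables l)"
  interpret normal N ?G by (rule N)
  let ?D = "\<lambda>y. \<exists>l. \<exists>n\<in>N. reduced q l \<and> y = n \<otimes>\<^bsub>?G\<^esub> ?W l"
  have oneN: "\<one>\<^bsub>?G\<^esub> \<in> N"
    by (rule subgroup.one_closed[OF subgroup_axioms])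
  have WCons: "?W ((g, m) # l) = generator R g [^]\<^bsub>?G\<^esub> m \<otimes>\<^bsub>?G\<^esub> ?W l" for g m l
    by (simp add: syllables_def flip: presented_group_mult word_class_word_pow)
  have zero: "generator R g [^]\<^bsub>?G\<^esub> m \<in> N" if "q g dvd m" for g and m :: int
    using that subgroup_int_pow_closed[OF subgroup_axioms q[of g]] generator_closed[of R g]
    by (auto simp: int_pow_pow elim!: dvdE)
  have step: "?D (generator R g [^]\<^bsub>?G\<^esub> m \<otimes>\<^bsub>?G\<^esub> ?W l)"
    if l: "reduced q l" for g l and m :: int
  proof -
    have push: "?D (generator R g [^]\<^bsub>?G\<^esub> m \<otimes>\<^bsub>?G\<^esub> ?W l)" if "l = [] \<or> fst (hd l) \<noteq> g"
    proof (cases "q g dvd m")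
      case True
      with l show ?thesis by (intro exI[of _ l] bexI[OF _ zero[OF True]]) simp
    next
      case False
      then have "reduced q ((g, m) # l)" using l that by (simp add: reduced_Cons)
      moreover have "generator R g [^]\<^bsub>?G\<^esub> m \<otimes>\<^bsub>?G\<^esub> ?W l = \<one>\<^bsub>?G\<^esub> \<otimes>\<^bsub>?G\<^esub> ?W ((g, m) # l)"
        using WCons by simp
      ultimately show ?thesis by (intro exI[of _ "(g, m) # l"] bexI[OF _ oneN] conjI)
    qed
    show ?thesis
    proof (cases "l = [] \<or> fst (hd l) \<noteq> g")
      case False
      then obtain m' l2 where l2: "l = (g, m') # l2" by (cases l) auto
      \<comment> \<open>The new power merges with the first syllable. If the merged power lies in N
        it disappears, leaving the tail \<open>l2\<close>, which is reduced already.\<close>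
      have eq: "generator R g [^]\<^bsub>?G\<^esub> m \<otimes>\<^bsub>?G\<^esub> ?W l = generator R g [^]\<^bsub>?G\<^esub> (m + m') \<otimes>\<^bsub>?G\<^esub> ?W l2"
        unfolding l2 WCons by (simp add: int_pow_mult m_assoc)
      show ?thesis
      proof (cases "q g dvd m + m'")
        case True
        moreover have "reduced q l2" using l by (simp add: l2 reduced_Cons)
        ultimately show ?thesis
          unfolding eq by (intro exI[of _ l2] bexI[OF _ zero[OF True]]) simp
      next
        case False
        then have "reduced q ((g, m + m') # l2)" using l by (simp add: l2 reduced_Cons)
        moreover have "generator R g [^]\<^bsub>?G\<^esub> m \<otimes>\<^bsub>?G\<^esub> ?W l = \<one>\<^bsub>?G\<^esub> \<otimes>\<^bsub>?G\<^esub> ?W ((g, m + m') # l2)"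
          using WCons eq by simp
        ultimately show ?thesis by (intro exI[of _ "(g, m + m') # l2"] bexI[OF _ oneN] conjI)
      qed
    qed (rule push)
  qed
  have "?D (word_class R u)" for u
  proof (induction u)
    case Nil
    then show ?case
      by (intro exI[of _ "[]"] bexI[OF _ oneN])
        (simp_all add: reduced_def syllables_def one_presented_group presented_group_mult)
  next
    case (Cons y u)
    obtain g b where y: "y = (g, b)" by (cases y)
    obtain l n where l: "reduced q l" and n: "n \<in> N" and u: "word_class R u = n \<otimes>\<^bsub>?G\<^esub> ?W l"
      using Cons by blast
    define z where "z = generator R g [^]\<^bsub>?G\<^esub> (if b then 1 else - 1 :: int)"
    have z: "z \<in> carrier ?G" using generator_closed by (simp add: z_def)
    have "[(g, b)] = word_pow g (if b then 1 else - 1)"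
      by (simp add: word_pow_def)
    then have "word_class R [(g, b)] = z"
      unfolding z_def by (simp only: word_class_word_pow)
    then have "word_class R (y # u) = z \<otimes>\<^bsub>?G\<^esub> (n \<otimes>\<^bsub>?G\<^esub> ?W l)"
      using presented_group_mult[of R "[(g, b)]" u] u y by simp
    \<comment> \<open>Normality of N lets z move past n, at the price of conjugating n.\<close>
    also have "\<dots> = (z \<otimes>\<^bsub>?G\<^esub> n \<otimes>\<^bsub>?G\<^esub> inv\<^bsub>?G\<^esub> z) \<otimes>\<^bsub>?G\<^esub> (z \<otimes>\<^bsub>?G\<^esub> ?W l)"
      using z n by (simp add: m_assoc inv_mult_cancel_left)
    finally have 1: "word_class R (y # u) = \<dots>" .
    obtain l' n' where l': "reduced q l'" "n' \<in> N" "z \<otimes>\<^bsub>?G\<^esub> ?W l = n' \<otimes>\<^bsub>?G\<^esub> ?W l'"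
      using step[OF l] unfolding z_def by blast
    then have "word_class R (y # u) = ((z \<otimes>\<^bsub>?G\<^esub> n \<otimes>\<^bsub>?G\<^esub> inv\<^bsub>?G\<^esub> z) \<otimes>\<^bsub>?G\<^esub> n') \<otimes>\<^bsub>?G\<^esub> ?W l'"
      using 1 z n by (simp add: m_assoc)
    then show ?case
      using l'
      by (intro exI[of _ l'] bexI[OF _ subgroup.m_closed[OF subgroup_axioms inv_op_closed2[OF z n]]] conjI)
  qed
  then show ?thesis using x by (auto simp: carrier_presented_group)
qed

section \<open>Actions of presented groups\<close>

definition action :: "('g \<times> bool \<Rightarrow> 'v \<Rightarrow> 'v) \<Rightarrow> 'g word set \<Rightarrow> 'v \<Rightarrow> 'v" where
  "action f U = foldr f (SOME u. u \<in> U)"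

text \<open>Inverses and relations have to hold only up to E, which will be congruence modulo p for
  the shears and equality for the permutations. Two words of one class may thus act differently,
  which is why \<open>action\<close> selects a representative.\<close>

locale word_action =
  fixes R :: "('g word \<times> 'g word) set" and f :: "'g \<times> bool \<Rightarrow> 'v \<Rightarrow> 'v"
    and E :: "'v \<Rightarrow> 'v \<Rightarrow> bool"
  assumes equivp: "equivp E"
    and letter_cong: "\<And>l v w. E v w \<Longrightarrow> E (f l v) (f l w)"
    and cancel: "\<And>x b v. E (f (x, b) (f (x, \<not> b) v)) v"
    and relation: "\<And>u w v. (u, w) \<in> R \<Longrightarrow> E (foldr f u v) (foldr f w v)"
begin

lemma foldr_cong: "E v w \<Longrightarrow> E (foldr f u v) (foldr f u w)"
  by (induction u) (simp_all add: letter_cong)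

lemma foldr_word_eq: "word_eq R u w \<Longrightarrow> E (foldr f u v) (foldr f w v)"
proof (induction arbitrary: v rule: word_eq.induct)
  case (append u u' w w')
  have "E (foldr f u (foldr f w v)) (foldr f u (foldr f w' v))"
    by (intro foldr_cong append.IH)
  then show ?case
    unfolding foldr_append o_apply by (rule equivp_transp[OF equivp _ append.IH(1)])
next
  case (sym u w)
  show ?case by (rule equivp_symp[OF equivp sym.IH])
next
  case (trans u w w')
  show ?case by (rule equivp_transp[OF equivp trans.IH])
qed (simp_all add: cancel relation equivp_reflp[OF equivp])

lemma action_word_class: "E (action f (word_class R u) v) (foldr f u v)"
proof -
  have "u \<in> word_class R u" by (simp add: word_class_def word_eq.refl)
  then have "word_eq R u (SOME w. w \<in> word_class R u)"
    using someI[of "\<lambda>w. w \<in> word_class R u" u] by (simp add: word_class_def)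
  then show ?thesis
    unfolding action_def by (rule equivp_symp[OF equivp foldr_word_eq])
qed

lemma action_mult:
  assumes "x \<in> carrier (presented_group R)" "y \<in> carrier (presented_group R)"
  shows "E (action f (x \<otimes>\<^bsub>presented_group R\<^esub> y) v) (action f x (action f y v))"
proof -
  obtain u w where x: "x = word_class R u" and y: "y = word_class R w"
    using assms by (auto simp: carrier_presented_group)
  have "E (action f (x \<otimes>\<^bsub>presented_group R\<^esub> y) v) (foldr f u (foldr f w v))"
    using action_word_class[of "u @ w" v] by (simp add: x y presented_group_mult)
  moreover have "E (action f x (action f y v)) (foldr f u (foldr f w v))"
    using action_word_class[of u "action f y v"] foldr_cong[OF action_word_class[of w v], of u]
    unfolding x y by (rule equivp_transp[OF equivp])
  ultimately show ?thesis
    using equivp_symp[OF equivp] equivp_transp[OF equivp] by blast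
qed

lemma action_one: "E (action f \<one>\<^bsub>presented_group R\<^esub> v) v"
  using action_word_class[of "[]"] by (simp add: one_presented_group)

text \<open>When E is equality the action is genuine and this set is its kernel. It will bound a
  normal closure from above.\<close>

lemma pointwise_stabilizer_normal:
  assumes E: "E = (=)"
  shows "{x \<in> carrier (presented_group R). \<forall>v. action f x v = v} \<lhd> presented_group R" (is "?M \<lhd> ?G")
proof -
  interpret group ?G by (rule group_presented_group)
  note mult = action_mult[unfolded E] and one = action_one[unfolded E]
  have inv: "action f (inv\<^bsub>?G\<^esub> x) (action f x v) = v" "action f x (action f (inv\<^bsub>?G\<^esub> x) v) = v"
    if "x \<in> carrier ?G" for x v
    using mult[of "inv\<^bsub>?G\<^esub> x" x v] mult[of x "inv\<^bsub>?G\<^esub> x" v] one that by simp_all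
  show ?thesis
  proof (rule normal_invI)
    show "subgroup ?M ?G"
    proof (rule subgroupI)
      have "\<one>\<^bsub>?G\<^esub> \<in> ?M" using one by simp
      then show "?M \<noteq> {}" by blast
    next
      fix x assume "x \<in> ?M"
      then show "inv\<^bsub>?G\<^esub> x \<in> ?M" using inv(1)[of x] by simp
    qed (auto simp: mult)
    show "x \<otimes>\<^bsub>?G\<^esub> h \<otimes>\<^bsub>?G\<^esub> inv\<^bsub>?G\<^esub> x \<in> ?M" if "x \<in> carrier ?G" "h \<in> ?M" for x h
      using that inv by (simp add: mult)
  qed
qed

end

section \<open>Words acting by shears modulo p\<close>

lemma funpow_shear_cong: "vec_cong p v w \<Longrightarrow> vec_cong p ((shear P ^^ n) v) ((shear P ^^ n) w)"
  by (induction n) (simp_all add: shear_cong)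

lemma funpow_unshear_cong: "vec_cong p v w \<Longrightarrow> vec_cong p ((unshear P ^^ n) v) ((unshear P ^^ n) w)"
  by (induction n) (simp_all add: unshear_cong)

lemma funpow_unshear_shear: "(unshear P ^^ n) ((shear P ^^ n) v) = v"
proof (induction n)
  case (Suc n)
  have "(unshear P ^^ Suc n) ((shear P ^^ Suc n) v) = (unshear P ^^ n) (unshear P (shear P ((shear P ^^ n) v)))"
    by (simp add: funpow_swap1)
  then show ?case
    by (simp only: unshear_shear Suc)
qed simp

lemmas vec_cong_refl = equivp_reflp[OF equivp_vec_cong]
  and vec_cong_sym = equivp_symp[OF equivp_vec_cong]
  and vec_cong_trans = equivp_transp[OF equivp_vec_cong]

lemma funpow_shear_mod:
  fixes p :: nat
  assumes p: "prime p" and window: "\<And>j. \<exists>l\<in>{j..<j + p ^ e}. \<not> P l"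
  shows "vec_cong p ((shear P ^^ n) v) ((shear P ^^ (n mod p ^ e)) v)"
proof (induction n rule: less_induct)
  case (less n)
  show ?case
  proof (cases "n < p ^ e")
    case False
    then have n: "n = (n - p ^ e) + p ^ e" by simp
    have "vec_cong p ((shear P ^^ (n - p ^ e)) ((shear P ^^ (p ^ e)) v)) ((shear P ^^ (n - p ^ e)) v)"
      by (intro funpow_shear_cong funpow_shear_prime_power assms)
    then have "vec_cong p ((shear P ^^ n) v) ((shear P ^^ (n - p ^ e)) v)"
      by (subst n) (simp only: funpow_add o_apply)
    moreover have "vec_cong p ((shear P ^^ (n - p ^ e)) v) ((shear P ^^ ((n - p ^ e) mod p ^ e)) v)"
      using False zero_less_power[OF prime_gt_0_nat[OF p], of e] by (intro less) linarith
    moreover have "(n - p ^ e) mod p ^ e = n mod p ^ e"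
      using False by (simp add: le_mod_geq)
    ultimately show ?thesis
      by (simp add: vec_cong_trans)
  qed (simp add: vec_cong_refl)
qed

text \<open>The Magnus substitution g -> 1 + X, where X depends on g and shifts along the edges in
  \<open>P g\<close>.\<close>

definition shear_letter :: "('g \<Rightarrow> nat \<Rightarrow> bool) \<Rightarrow> 'g \<times> bool \<Rightarrow> (nat \<Rightarrow> int) \<Rightarrow> nat \<Rightarrow> int" where
  "shear_letter P = (\<lambda>(g, b). if b then shear (P g) else unshear (P g))"

lemma foldr_shear_letter_word_pow:
  fixes p :: nat
  assumes p: "prime p" and window: "\<And>j. \<exists>l\<in>{j..<j + p ^ e}. \<not> P g l"
  shows "vec_cong p (foldr (shear_letter P) (word_pow g n) v) ((shear (P g) ^^ nat (n mod int (p ^ e))) v)"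
proof (cases "n \<ge> 0")
  case True
  then have "nat (n mod int (p ^ e)) = nat n mod p ^ e"
    by (simp add: nat_mod_distrib nat_power_eq)
  then show ?thesis
    using funpow_shear_mod[of p e "P g", OF assms] True
    by (simp add: word_pow_def shear_letter_def)
next
  case False
  \<comment> \<open>For a negative exponent, m + r is a multiple of p^e, so the shear to the power m
    + r is trivial modulo p; undoing m of the factors identifies the inverse power with the r-th
    power.\<close>
  let ?m = "nat (- n)" and ?r = "nat (n mod int (p ^ e))"
  have "int ?r = n mod int (p ^ e)"
    using prime_gt_0_nat[OF p] by simp
  then have "int (?m + ?r) = - n + n mod int (p ^ e)"
    using False by simp
  then have "int (p ^ e) dvd int (?m + ?r)"
    by (simp add: minus_mod_eq_mult_div flip: minus_diff_eq[of n])
  then have "(?m + ?r) mod p ^ e = 0"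
    by (simp only: of_nat_dvd_iff flip: dvd_eq_mod_eq_0)
  then have "vec_cong p ((shear (P g) ^^ (?m + ?r)) v) v"
    using funpow_shear_mod[of p e "P g" "?m + ?r", OF assms] by simp
  then have "vec_cong p ((unshear (P g) ^^ ?m) ((shear (P g) ^^ (?m + ?r)) v)) ((unshear (P g) ^^ ?m) v)"
    by (rule funpow_unshear_cong)
  then show ?thesis
    using False
    by (simp add: word_pow_def shear_letter_def funpow_add funpow_unshear_shear vec_cong_sym)
qed

lemma foldr_shear_letter_syllables:
  fixes p :: nat
  assumes p: "prime p" and window: "\<And>g j. \<exists>l\<in>{j..<j + p ^ e g}. \<not> P g l"
  shows "vec_cong p (foldr (shear_letter P) (syllables l) v)
    (foldr (\<lambda>(g, n). shear (P g) ^^ n) (map (\<lambda>(g, n). (g, nat (n mod int (p ^ e g)))) l) v)"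
proof (induction l)
  case Nil
  then show ?case by (simp add: syllables_def vec_cong_refl)
next
  case (Cons s l)
  obtain g n where s: "s = (g, n)" by (cases s)
  have "foldr (shear_letter P) (syllables (s # l)) v
      = foldr (shear_letter P) (word_pow g n) (foldr (shear_letter P) (syllables l) v)"
    by (simp add: s syllables_def)
  then show ?case
    using vec_cong_trans[OF foldr_shear_letter_word_pow[OF p window] funpow_shear_cong[OF Cons]]
    by (simp add: s)
qed

lemma shear_letter_add: "shear_letter P l (v + w) = shear_letter P l v + shear_letter P l w"
  by (cases l) (simp only: shear_letter_def shear_add unshear_add split: prod.split if_split, simp)

lemma foldr_shear_letter_add:
  "foldr (shear_letter P) u (v + w) = foldr (shear_letter P) u v + foldr (shear_letter P) u w"
  by (induction u) (simp_all only: foldr.simps o_apply id_apply shear_letter_add)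

text \<open>The filtration supplied to \<open>lower_central_shift\<close>. Step 0 contains all
  sequences, and the intersection of all steps consists of those that are zero modulo p.\<close>

definition vanishing :: "int \<Rightarrow> nat \<Rightarrow> (nat \<Rightarrow> int) set" where
  "vanishing p n = {v. \<forall>j<n. p dvd v j}"

lemma vec_cong_vanishing: "vec_cong p v w \<Longrightarrow> v - w \<in> vanishing p n"
  by (simp add: vec_cong_def vanishing_def cong_iff_dvd_diff)

lemma vanishing_add: "v \<in> vanishing p n \<Longrightarrow> w \<in> vanishing p n \<Longrightarrow> v + w \<in> vanishing p n"
  by (simp add: vanishing_def)

lemma vanishing_Suc: "vanishing p (Suc n) \<subseteq> vanishing p n"
  by (auto simp: vanishing_def)

text \<open>A letter changes entry j only by an entry with index j - 1, of v itself or of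
  \<open>unshear P v\<close>, and those are divisible by p for j - 1 < n.\<close>

lemma shear_letter_shift:
  assumes "v \<in> vanishing p n"
  shows "shear_letter P l v - v \<in> vanishing p (Suc n)"
proof -
  have "p dvd unshear P v j" if "j < n" for P j
    using that assms by (induction j) (auto simp: vanishing_def)
  then have "p dvd unshear P v j - v j" if "j < Suc n" for P j
    using that by (cases j) auto
  moreover have "p dvd shear P v j - v j" if "j < Suc n" for P j
    using that assms by (cases j) (auto simp: shear_def vanishing_def)
  ultimately show ?thesis
    by (cases l) (simp add: vanishing_def shear_letter_def)
qed

lemma foldr_shear_letter_shift:
  assumes "v \<in> vanishing p n"
  shows "foldr (shear_letter P) u v - v \<in> vanishing p (Suc n)"
proof (induction u)
  case Nil
  then show ?case by (simp add: vanishing_def)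
next
  case (Cons l u)
  let ?w = "foldr (shear_letter P) u v"
  have "?w = (?w - v) + v" by simp
  then have "?w \<in> vanishing p n"
    using vanishing_add[OF _ assms, of "?w - v"] Cons vanishing_Suc by fastforce
  \<comment> \<open>Telescoping: (l u - 1) v = (l - 1) u v + (u - 1) v.\<close>
  then have "(shear_letter P l ?w - ?w) + (?w - v) \<in> vanishing p (Suc n)"
    using Cons by (intro vanishing_add shear_letter_shift)
  then show ?case by (simp only: foldr.simps o_apply add_diff_eq diff_add_cancel)
qed

definition edge :: "'g list \<Rightarrow> 'g \<Rightarrow> nat \<Rightarrow> bool" where
  "edge s g j \<longleftrightarrow> j < length s \<and> s ! j = g"

text \<open>Entry j is preserved because the element lies in term j + 1 of the series, which moves
  an arbitrary sequence, taken from filtration step 0, only by an element of step j + 1.\<close>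

lemma shear_action_lower_central_omega:
  assumes "word_action R (shear_letter P) (vec_cong p)"
    and u: "word_class R u \<in> lower_central_omega (presented_group R)"
  shows "vec_cong p (foldr (shear_letter P) u v) v"
  unfolding vec_cong_def
proof
  fix j
  interpret word_action R "shear_letter P" "vec_cong p" by fact
  let ?f = "shear_letter P"
  have mem: "word_class R u \<in> lower_central (presented_group R) (Suc j)"
    using u by (simp add: lower_central_omega_def del: lower_central.simps)
  have "action ?f (word_class R u) v - v \<in> vanishing p (0 + Suc j)"
  proof (rule lower_central_shift[where F = "vanishing p" and act = "action ?f" and n = 0
        and i = "Suc j" and v = v and x = "word_class R u", OF group_presented_group[of R]])
    show "word_class R u \<in> lower_central (presented_group R) (Suc j)"
      by (rule mem)
    show "v - w \<in> vanishing p n" if "v \<in> vanishing p n" "w \<in> vanishing p n" for v w n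
      using that by (simp add: vanishing_def)
    show "action ?f x v - v \<in> vanishing p (Suc n)" if "v \<in> vanishing p n" for x v n
      unfolding action_def by (rule foldr_shear_letter_shift[OF that])
    show "action ?f x (v + w) = action ?f x v + action ?f x w" for x v w
      unfolding action_def by (rule foldr_shear_letter_add)
    show "vanishing p (Suc n) \<subseteq> vanishing p n" for n
      by (rule vanishing_Suc)
  qed (use action_mult action_one vec_cong_vanishing in \<open>auto simp: vanishing_def\<close>)
  then have "[action ?f (word_class R u) v j = v j] (mod p)"
    by (simp add: vanishing_def cong_iff_dvd_diff)
  moreover have "[foldr ?f u v j = action ?f (word_class R u) v j] (mod p)"
    using vec_cong_sym[OF action_word_class[of u v]] by (simp add: vec_cong_def)
  ultimately show "[foldr ?f u v j = v j] (mod p)"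
    by (rule cong_trans[rotated])
qed

text \<open>Inside the path this is \<open>path_window\<close>; a window reaching beyond the end
  finishes at a position without an edge.\<close>

lemma edge_window:
  assumes "distinct_adj (map fst L)" "\<forall>(g, n)\<in>set L. 0 < n \<and> n < q g" "0 < q h"
  shows "\<exists>l\<in>{j..<j + q h}. \<not> edge (path L) h l"
proof (cases "j + q h \<le> length (path L)")
  case True
  then show ?thesis
    using path_window[of L q h j] assms by (auto simp: edge_def)
next
  case False
  then show ?thesis
    using assms(3) by (intro bexI[of _ "j + q h - 1"]) (auto simp: edge_def)
qed

section \<open>Baumslag-Solitar groups\<close>

locale baumslag_solitar =
  fixes k d :: int
  assumes d: "d \<ge> 1"
begin

abbreviation "R \<equiv> BS_relations (k * d) (k * d + d)"
abbreviation "G \<equiv> presented_group R"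
abbreviation "a \<equiv> generator R Gen_a"
abbreviation "t \<equiv> generator R Gen_t"
abbreviation "N \<equiv> normal_closure G {a [^]\<^bsub>G\<^esub> d}"

sublocale group G by (rule group_presented_group)

section \<open>The normal closure of a^d lies in every term\<close>

lemma relation_group: "inv\<^bsub>G\<^esub> t \<otimes>\<^bsub>G\<^esub> a [^]\<^bsub>G\<^esub> (k * d) \<otimes>\<^bsub>G\<^esub> t = a [^]\<^bsub>G\<^esub> (k * d + d)"
proof -
  have "word_class R (word_pow Gen_t (-1) @ word_pow Gen_a (k * d) @ word_pow Gen_t 1)
      = word_class R (word_pow Gen_a (k * d + d))"
    unfolding word_class_eq_iff by (rule word_eq.relation) (simp add: BS_relations_def)
  then have "t [^]\<^bsub>G\<^esub> (- 1 :: int) \<otimes>\<^bsub>G\<^esub> (a [^]\<^bsub>G\<^esub> (k * d) \<otimes>\<^bsub>G\<^esub> t [^]\<^bsub>G\<^esub> (1 :: int)) = a [^]\<^bsub>G\<^esub> (k * d + d)"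
    by (simp only: word_class_word_pow flip: presented_group_mult)
  then show ?thesis
    by (simp add: int_pow_neg m_assoc)
qed

text \<open>A term containing a^d contains a^(kd), and the relation identifies the commutator of
  a^(kd) with t as a^d, which therefore lies in the next term.\<close>

lemma a_pow_d_lower_central: "a [^]\<^bsub>G\<^esub> d \<in> lower_central G (Suc i)"
proof (induction i)
  case 0
  show ?case by simp
next
  case (Suc i)
  have "subgroup (lower_central G (Suc i)) G"
    by (intro normal_imp_subgroup lower_central_normal) simp
  from subgroup_int_pow_closed[OF this Suc, of k]
  have akd: "a [^]\<^bsub>G\<^esub> (k * d) \<in> lower_central G (Suc i)"
    by (simp only: int_pow_pow[OF generator_closed] mult.commute[of d k])
  have "inv\<^bsub>G\<^esub> (a [^]\<^bsub>G\<^esub> (k * d)) \<otimes>\<^bsub>G\<^esub> inv\<^bsub>G\<^esub> t \<otimes>\<^bsub>G\<^esub> a [^]\<^bsub>G\<^esub> (k * d) \<otimes>\<^bsub>G\<^esub> t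
      = a [^]\<^bsub>G\<^esub> (- (k * d)) \<otimes>\<^bsub>G\<^esub> a [^]\<^bsub>G\<^esub> (k * d + d)"
    unfolding relation_group[symmetric] by (simp add: m_assoc int_pow_neg)
  also have "\<dots> = a [^]\<^bsub>G\<^esub> d"
    by (subst int_pow_mult[symmetric]) simp_all
  finally show ?case
    using commutator_mem_lower_central[OF akd, of t] by simp
qed

lemma N_normal: "N \<lhd> G"
  by (rule normal_closure_normal) simp

lemma N_le_lower_central_omega: "N \<subseteq> lower_central_omega G"
proof -
  have "N \<subseteq> lower_central G i" if "i \<ge> 1" for i
    using that a_pow_d_lower_central[of "i - 1"]
    by (intro normal_closure_least lower_central_normal) auto
  then show ?thesis by (auto simp: lower_central_omega_def)
qed

section \<open>The case of a prime power d\<close>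

lemma shear_word_action:
  fixes p :: nat
  assumes p: "prime p" and dp: "d = int (p ^ e)"
    and window: "\<And>j. \<exists>l\<in>{j..<j + p ^ e}. \<not> P Gen_a l"
  shows "word_action R (shear_letter P) (vec_cong p)"
proof
  show "equivp (vec_cong p)" by (rule equivp_vec_cong)
  show "vec_cong p (shear_letter P l v) (shear_letter P l w)" if "vec_cong p v w" for l v w
    using that by (cases l) (simp add: shear_letter_def shear_cong unshear_cong)
  show "vec_cong p (shear_letter P (x, b) (shear_letter P (x, \<not> b) v)) v" for x b v
    by (simp add: shear_letter_def shear_unshear unshear_shear vec_cong_refl)
  \<comment> \<open>Both exponents of a in the relation are multiples of d = p^e, so these powers
    act trivially modulo p and the relation reduces to t^-1 t = 1.\<close>
  have a: "vec_cong p (foldr (shear_letter P) (word_pow Gen_a m) v) v" if "d dvd m" for m v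
    using foldr_shear_letter_word_pow[where P = P and g = Gen_a, OF p window, of m v] that by (simp add: dp)
  have "vec_cong p (foldr (shear_letter P) (word_pow Gen_t (-1) @ word_pow Gen_a (k * d) @ word_pow Gen_t 1) v) v" for v
    using unshear_cong[OF a[of "k * d" "shear (P Gen_t) v"], of "P Gen_t"]
    by (simp add: word_pow_def shear_letter_def unshear_shear)
  note rel = vec_cong_trans[OF this vec_cong_sym[OF a[of "k * d + d"]]]
  show "vec_cong p (foldr (shear_letter P) u v) (foldr (shear_letter P) w v)"
    if "(u, w) \<in> R" for u w v
  proof -
    have "u = word_pow Gen_t (-1) @ word_pow Gen_a (k * d) @ word_pow Gen_t 1"
      "w = word_pow Gen_a (k * d + d)"
      using that by (simp_all add: BS_relations_def)
    then show ?thesis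
      using rel[of v] by simp
  qed
qed

lemma lower_central_omega_le_N:
  fixes p :: nat
  assumes p: "prime p" and dp: "d = int (p ^ e)"
  shows "lower_central_omega G \<subseteq> N"
proof
  fix x assume x: "x \<in> lower_central_omega G"
  interpret N: normal N G by (rule N_normal)
  have omega: "lower_central_omega G \<subseteq> carrier G"
    unfolding lower_central_omega_def by force
  \<comment> \<open>The orders of the free factors of Z/d * Z, with 0 for the infinite one.\<close>
  define q0 where "q0 = case_bs_gen d 0"
  have "a [^]\<^bsub>G\<^esub> d \<in> N" using normal_closure_incl by blast
  then have "generator R g [^]\<^bsub>G\<^esub> q0 g \<in> N" for g
    by (cases g) (simp_all add: q0_def)
  then obtain l n where l: "reduced q0 l" and n: "n \<in> N"
    and xl: "x = n \<otimes>\<^bsub>G\<^esub> word_class R (syllables l)"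
    using reduced_syllables[OF N_normal, of q0 x] x omega by blast
  \<comment> \<open>Since N lies in all terms of the series, x may be replaced by its reduced word,
    and it remains to see that this word is empty.\<close>
  have "word_class R (syllables l) = inv\<^bsub>G\<^esub> n \<otimes>\<^bsub>G\<^esub> x"
    using n by (simp add: xl inv_mult_cancel_left)
  moreover have "subgroup (lower_central_omega G) G"
    unfolding lower_central_omega_def
    by (intro subgroups_Inter) (auto intro!: normal_imp_subgroup lower_central_normal)
  ultimately have y: "word_class R (syllables l) \<in> lower_central_omega G"
    using x n N_le_lower_central_omega by (auto simp: subgroup.m_closed subgroup.m_inv_closed)
  have "l = []"
  proof (rule ccontr)
    assume "l \<noteq> []"
    \<comment> \<open>With the sum of the absolute exponents as B, the modulus p^B exceeds every
      exponent, so no nonzero exponent of t becomes zero modulo p^B.\<close>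
    define B where "B = (\<Sum>(g, n)\<leftarrow>l. nat \<bar>n\<bar>)"
    have B: "nat \<bar>n\<bar> < p ^ B" if "(g, n) \<in> set l" for g n
    proof -
      have "nat \<bar>n\<bar> \<le> B"
        unfolding B_def using that by (intro member_le_sum_list) force+
      also have "B < p ^ B"
        using prime_gt_1_nat[OF p] by (simp add: power_gt_expt)
      finally show ?thesis .
    qed
    \<comment> \<open>For a the modulus must be p^e = d, as the relation demands; for t the modulus
      p^B is a free choice.\<close>
    define r where "r = case_bs_gen e B"
    define q where "q g = p ^ r g" for g
    define L where "L = map (\<lambda>(g, n). (g, nat (n mod int (q g)))) l"
    have q: "q g > 0" for g
      using prime_gt_0_nat[OF p] by (simp add: q_def)
    have not_dvd: "\<not> int (q g) dvd n" if "(g, n) \<in> set l" for g n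
    proof -
      \<comment> \<open>For a the two moduli agree. For t the exponent is nonzero and smaller than
        p^B in absolute value.\<close>
      have "\<not> q0 g dvd n"
        using l that by (auto simp: reduced_def)
      moreover have "\<bar>n\<bar> < int (p ^ B)"
        using B[OF that] by linarith
      ultimately show ?thesis
        using zdvd_imp_le[of "int (p ^ B)" "\<bar>n\<bar>"]
        by (cases g) (auto simp: q_def r_def q0_def dp)
    qed
    have "0 < nat (n mod int (q g)) \<and> nat (n mod int (q g)) < q g" if "(g, n) \<in> set l" for g n
    proof -
      have "n mod int (q g) \<noteq> 0"
        using not_dvd[OF that] by (simp only: dvd_eq_mod_eq_0 not_False_eq_True)
      moreover have "0 \<le> n mod int (q g)" "n mod int (q g) < int (q g)"
        using q[of g] by simp_all
      ultimately show ?thesis by linarith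
    qed
    then have L: "\<forall>(g, n)\<in>set L. 0 < n \<and> n < q g"
      by (auto simp: L_def)
    have "map fst L = map fst l"
      by (auto simp: L_def)
    then have "distinct_adj (map fst L)"
      using l by (simp add: reduced_def)
    then have window: "\<exists>l\<in>{j..<j + p ^ r g}. \<not> edge (path L) g l" for g j
      using edge_window[OF _ L q] by (simp add: q_def)
    let ?f = "shear_letter (edge (path L))"
    have "word_action R ?f (vec_cong p)"
      using window[of _ Gen_a] by (intro shear_word_action[OF p dp]) (simp add: r_def)
    then have fixed: "vec_cong p (foldr ?f (syllables l) start) start"
      by (rule shear_action_lower_central_omega[OF _ y])
    \<comment> \<open>The entry at the end of the path is now computed twice: it is 1 as the
      coefficient of the full monomial, and 0 because the word fixes \<open>start\<close> modulo p
      and the path is not empty.\<close>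
    have "vec_cong p (foldr ?f (syllables l) start)
        (foldr (\<lambda>(g, n). shear (edge (path L) g) ^^ n) L start)"
      using foldr_shear_letter_syllables[where e = r and l = l and v = start, OF p window]
      by (simp add: L_def q_def)
    from vec_cong_trans[OF vec_cong_sym[OF this] fixed]
    have "[foldr (\<lambda>(g, n). shear (edge (path L) g) ^^ n) L start (length (path L))
        = start (length (path L))] (mod int p)"
      by (simp add: vec_cong_def)
    moreover have "foldr (\<lambda>(g, n). shear (edge (path L) g) ^^ n) L start (length (path L)) = 1"
      using foldr_shear_path[of L "edge (path L)"] by (simp add: edge_def)
    moreover have "path L \<noteq> []"
      using L \<open>l \<noteq> []\<close> by (intro path_last) (auto simp: L_def)
    ultimately have "[1 = 0] (mod int p)"
      by (simp add: start_def)
    then show False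
      using p by (simp add: cong_iff_dvd_diff)
  qed
  then show "x \<in> N"
    using n xl by (simp add: syllables_def flip: one_presented_group)
qed

section \<open>The case of two coprime factors of d\<close>

definition perm_letter :: "bs_gen \<times> bool \<Rightarrow> int \<Rightarrow> int" where
  "perm_letter = (\<lambda>(g, b) z. case g of
    Gen_a \<Rightarrow> if 0 \<le> z \<and> z < d then (z + (if b then 1 else - 1)) mod d else z
  | Gen_t \<Rightarrow> if z = 0 then d else if z = d then 0 else z)"

lemma foldr_perm_letter_a:
  "foldr perm_letter (word_pow Gen_a n) z = (if 0 \<le> z \<and> z < d then (z + n) mod d else z)"
proof -
  have "(perm_letter (Gen_a, b) ^^ m) z
      = (if 0 \<le> z \<and> z < d then (z + (if b then int m else - int m)) mod d else z)" for b m
    using d by (induction m) (auto simp: perm_letter_def mod_simps algebra_simps)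
  then show ?thesis
    by (simp add: word_pow_def)
qed

sublocale perm: word_action R perm_letter "(=)"
proof
  show "equivp ((=) :: int \<Rightarrow> int \<Rightarrow> bool)" by (rule identity_equivp)
  show "perm_letter (x, b) (perm_letter (x, \<not> b) z) = z" for x b z
    using d by (cases x) (auto simp: perm_letter_def mod_simps)
  show "foldr perm_letter u z = foldr perm_letter w z" if "(u, w) \<in> R" for u w z
  proof -
    \<comment> \<open>The cycle has length d, so both powers of a in the relation act trivially and
      only t^-1 t remains, a transposition applied twice.\<close>
    have "foldr perm_letter (word_pow Gen_a m) z = z" if "d dvd m" for m z
      using that by (auto simp: foldr_perm_letter_a elim!: dvdE)
    then show ?thesis
      using that d by (auto simp: BS_relations_def word_pow_def[of Gen_t] perm_letter_def)
  qed
qed simp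

lemma N_psubset_lower_central_omega:
  fixes u v :: nat
  assumes dp: "d = int (u * v)" and "coprime u v" and uv: "1 < u" "1 < v"
  shows "N \<subset> lower_central_omega G"
proof -
  define x where "x = a [^]\<^bsub>G\<^esub> int u"
  define y where "y = inv\<^bsub>G\<^esub> t \<otimes>\<^bsub>G\<^esub> a [^]\<^bsub>G\<^esub> int v \<otimes>\<^bsub>G\<^esub> t"
  define c where "c = inv\<^bsub>G\<^esub> x \<otimes>\<^bsub>G\<^esub> inv\<^bsub>G\<^esub> y \<otimes>\<^bsub>G\<^esub> x \<otimes>\<^bsub>G\<^esub> y"
  have x: "x \<in> carrier G" and y: "y \<in> carrier G" and c: "c \<in> carrier G"
    by (simp_all add: x_def y_def c_def)
  have "(a [^]\<^bsub>G\<^esub> int u) [^]\<^bsub>G\<^esub> v = a [^]\<^bsub>G\<^esub> (int u * int v)"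
    and av: "(a [^]\<^bsub>G\<^esub> int v) [^]\<^bsub>G\<^esub> u = a [^]\<^bsub>G\<^esub> (int v * int u)"
    by (simp_all only: int_pow_pow[OF generator_closed] flip: int_pow_int)
  moreover have uv_d: "int u * int v = d" "int v * int u = d"
    by (simp_all add: dp)
  ultimately have "x [^]\<^bsub>G\<^esub> v = a [^]\<^bsub>G\<^esub> d"
    by (simp only: x_def)
  then have xv: "x [^]\<^bsub>G\<^esub> v \<in> lower_central G (Suc i)" for i
    using a_pow_d_lower_central by simp
  have "y [^]\<^bsub>G\<^esub> n = inv\<^bsub>G\<^esub> t \<otimes>\<^bsub>G\<^esub> (a [^]\<^bsub>G\<^esub> int v) [^]\<^bsub>G\<^esub> n \<otimes>\<^bsub>G\<^esub> t" for n :: nat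
    by (induction n) (simp_all add: y_def m_assoc inv_mult_cancel_left)
  from this[of u] have "y [^]\<^bsub>G\<^esub> u = inv\<^bsub>G\<^esub> t \<otimes>\<^bsub>G\<^esub> a [^]\<^bsub>G\<^esub> d \<otimes>\<^bsub>G\<^esub> t"
    by (simp only: av uv_d)
  then have yu: "y [^]\<^bsub>G\<^esub> u \<in> lower_central G (Suc i)" for i
    using normal.inv_op_closed1[OF lower_central_normal _ a_pow_d_lower_central] by simp
  \<comment> \<open>The v-th power of x and the u-th power of y lie in all terms, so u and v
    exchange their places in \<open>coprime_pow_commutator\<close>.\<close>
  have "c \<in> lower_central G (Suc (i - 1))" for i
    unfolding c_def
    by (rule coprime_pow_commutator[OF x y _ xv yu]) (use \<open>coprime u v\<close> in \<open>simp add: coprime_commute\<close>)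
  then have "c \<in> lower_central G i" if "i \<ge> 1" for i
    using that by (metis Suc_diff_1 Suc_le_eq One_nat_def)
  then have "c \<in> lower_central_omega G"
    by (simp add: lower_central_omega_def)
  moreover have "c \<notin> N"
  proof
    assume "c \<in> N"
    have "action perm_letter (a [^]\<^bsub>G\<^esub> n) z = foldr perm_letter (word_pow Gen_a n) z" for n z
      using perm.action_word_class by (simp flip: word_class_word_pow)
    note act_a = this[unfolded foldr_perm_letter_a]
    \<comment> \<open>The kernel of the permutation action contains a^d and hence N. So c in N would
      make x and y commute as permutations.\<close>
    have "N \<subseteq> {x \<in> carrier G. \<forall>z. action perm_letter x z = z}"
      by (intro normal_closure_least perm.pointwise_stabilizer_normal) (auto simp: act_a)
    then have cz: "action perm_letter c z = z" for z
      using \<open>c \<in> N\<close> by blast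
    have "x \<otimes>\<^bsub>G\<^esub> y = y \<otimes>\<^bsub>G\<^esub> x \<otimes>\<^bsub>G\<^esub> c"
      unfolding c_def by (rule mult_eq_swap_commutator[OF x y])
    then have comm: "action perm_letter x (action perm_letter y z)
        = action perm_letter y (action perm_letter x z)" for z
      using perm.action_mult[of x y z] perm.action_mult[of "y \<otimes>\<^bsub>G\<^esub> x" c z] perm.action_mult[of y x z] x y c cz
      by simp
    have "y = word_class R (word_pow Gen_t (-1) @ word_pow Gen_a (int v) @ word_pow Gen_t 1)"
      by (simp add: y_def word_class_word_pow int_pow_neg m_assoc flip: presented_group_mult)
    then have "action perm_letter y z
        = foldr perm_letter (word_pow Gen_t (-1) @ word_pow Gen_a (int v) @ word_pow Gen_t 1) z" for z
      using perm.action_word_class by simp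
    then have act_y: "action perm_letter y z = perm_letter (Gen_t, False)
        (foldr perm_letter (word_pow Gen_a (int v)) (perm_letter (Gen_t, True) z))" for z
      by (simp add: word_pow_def[of Gen_t])
    have perm_t: "perm_letter (Gen_t, b) z = (if z = 0 then d else if z = d then 0 else z)" for b z
      by (simp add: perm_letter_def)
    have ud: "int u < d" "int v < d"
      using uv by (simp_all add: dp)
    \<comment> \<open>The test point is 0: t moves it to d, which a fixes, so y fixes 0, while x
      sends 0 to u. Commuting forces y to fix u as well, but on u it starts as addition of v modulo
      d.\<close>
    have "action perm_letter y 0 = 0"
      using d by (simp add: act_y foldr_perm_letter_a perm_t)
    moreover have "action perm_letter x 0 = int u"
      using d ud by (simp add: x_def act_a)
    ultimately have "action perm_letter y (int u) = int u"
      using comm[of 0] by simp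
    then have "(int u + int v) mod d = int u"
      using uv ud d by (simp add: act_y foldr_perm_letter_a perm_t split: if_splits)
    then have "(int u + int v) mod d = int u mod d"
      using ud by simp
    then have "d dvd int v"
      by (metis add_diff_cancel_left' mod_eq_dvd_iff)
    then show False
      using ud uv zdvd_imp_le by force
  qed
  ultimately show ?thesis
    using N_le_lower_central_omega by blast
qed

end

text \<open>For any prime divisor p of d, split off the full power of p; the cofactor is not 1
  because d is not a prime power.\<close>

lemma not_primepow_coprime_factors:
  fixes d :: int
  assumes "d > 1" "\<not> primepow d"
  obtains u v :: nat where "d = int (u * v)" "coprime u v" "1 < u" "1 < v"
proof -
  have "nat d \<noteq> 1" using assms by linarith
  then obtain p where p: "prime p" "p dvd nat d"
    using prime_factor_nat by blast
  let ?m = "multiplicity p (nat d)"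
  obtain v where v: "nat d = p ^ ?m * v" "\<not> p dvd v"
    using multiplicity_decompose'[of "nat d" p] prime_gt_1_nat[OF p(1)] assms(1) by auto
  have m: "?m > 0"
    using p v by (metis gr0I mult_1 power_0)
  have "v \<noteq> 1"
  proof
    assume "v = 1"
    then have "d = int p ^ ?m"
      using v(1) assms(1) by (simp flip: of_nat_power)
    then show False
      using assms(2) m p(1) unfolding primepow_def by (metis prime_nat_int_transfer)
  qed
  moreover have "v \<noteq> 0"
    using v(2) by (intro notI) simp
  moreover have "coprime (p ^ ?m) v"
    using p v by (simp add: prime_imp_coprime)
  moreover have "d = int (p ^ ?m * v)"
    using v(1) assms(1) by linarith
  moreover have "1 < p ^ ?m"
    using one_less_power[OF prime_gt_1_nat[OF p(1)] m] .
  ultimately show ?thesis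
    by (intro that[of "p ^ ?m" v]) auto
qed

theorem theorem3:
  fixes k d :: int and G :: "bs_gen word set monoid" and a :: "bs_gen word set"
  assumes "k \<ge> 1" and "d \<ge> 1"
    and "G = BS (k * d) (k * d + d)" and "a = BS_a (k * d) (k * d + d)"
  shows "(primepow d \<or> d = 1 \<longrightarrow> lower_central_omega G = normal_closure G {a [^]\<^bsub>G\<^esub> d}) \<and>
    (d > 1 \<and> \<not> primepow d \<longrightarrow> normal_closure G {a [^]\<^bsub>G\<^esub> d} \<subset> lower_central_omega G)"
proof -
  interpret bs: baumslag_solitar k d
    using assms(2) by unfold_locales
  have prime_power: "\<exists>p e. prime p \<and> d = int (p ^ e)" if "primepow d \<or> d = 1"
    using that
  proof
    assume "primepow d"
    then obtain p n where p: "prime p" "d = p ^ n"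
      by (auto simp: primepow_def)
    obtain q where "p = int q"
      using prime_ge_0_int[OF p(1)] by (rule nonneg_int_cases)
    then have "prime q \<and> d = int (q ^ n)"
      using p by simp
    then show ?thesis by blast
  next
    \<comment> \<open>Writing 1 as a zeroth power lets the prime power argument cover this case
      too.\<close>
    assume "d = 1"
    then have "prime (2 :: nat) \<and> d = int (2 ^ 0)" by simp
    then show ?thesis by blast
  qed
  have G: "G = bs.G" and a: "a = bs.a"
    using assms(3,4) by (simp_all only: BS_def BS_a_def)
  show ?thesis
    unfolding G a
  proof (intro conjI impI)
    assume "primepow d \<or> d = 1"
    then obtain p e where "prime p" "d = int (p ^ e)"
      using prime_power by blast
    then show "lower_central_omega bs.G = bs.N"
      using bs.lower_central_omega_le_N bs.N_le_lower_central_omega by blast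
  next
    assume "1 < d \<and> \<not> primepow d"
    then obtain u v :: nat where "d = int (u * v)" "coprime u v" "1 < u" "1 < v"
      using not_primepow_coprime_factors by blast
    then show "bs.N \<subset> lower_central_omega bs.G"
      by (rule bs.N_psubset_lower_central_omega)
  qed
qed

end
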